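(* Let $N\geq 3$ be an integer and let $k\in\{1,2,\ldots,[N/2]\}$ if $N$ is odd, or $k\in\{1,2,\ldots,[N/2]-1\}$ if $N$ is even. Let $p:[0,\infty)\to(0,\infty)$ and $h:[0,\infty)\to[0,\infty)$ be continuous functions such that: (i) $r^{N+\frac{N}{k}-2}p^{k}(r)$ is nondecreasing for large $r$; (ii) $h$ is monotone non-decreasing, $h(0)=0$ and $h(s)>0$ for all $s>0$; (iii) $\displaystyle\int_{1}^{\infty}\frac{1}{\sqrt[k+1]{(k+1)H(t)}}\,dt=\infty$, where $H(t)=\int_{0}^{t}h^{k}(z)\,dz$. If there exists a positive number $\varepsilon$ such that $$\int_{0}^{\infty}t^{1+\varepsilon+\frac{2(k-1)}{k+1}}\left(p(t)\right)^{\frac{2k}{k+1}}dt<\infty,$$ then the equation $$S_{k}^{1/k}\left(\lambda\left(D^{2}u\right)\right)=p(|x|)\,h(u)\quad\text{in }\mathbb{R}^{N}$$ has a nonnegative nontrivial radial bounded solution $u\in\Phi^{k}(\mathbb{R}^{N})$.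
   Context: $[\cdot]$ denotes the integer part. For a $C^{2}$ function $u$ on $\mathbb{R}^{N}$, $D^{2}u$ is its Hessian matrix and $\lambda(D^{2}u)=(\lambda_{1},\ldots,\lambda_{N})$ is the vector of eigenvalues of $D^{2}u$. For $j=1,\ldots,N$, $S_{j}(\lambda)=\sum_{1\leq i_{1}<\cdots<i_{j}\leq N}\lambda_{i_{1}}\cdots\lambda_{i_{j}}$ is the $j$-th elementary symmetric polynomial, and $S_{k}^{1/k}$ denotes $(S_k)^{1/k}$. The Gårding open cone is $\Gamma_{k}(N)=\{\lambda\in\mathbb{R}^{N} : S_{1}(\lambda)>0,\ldots,S_{k}(\lambda)>0\}$, and the space of admissible (strictly $k$-convex) functions is $\Phi^{k}(\mathbb{R}^{N})=\{u\in C^{2}(\mathbb{R}^{N}) : \lambda(D^{2}u(x))\in\Gamma_{k}(N)\text{ for all }x\in\mathbb{R}^{N}\}$. "Nondecreasing for large $r$" means nondecreasing on $[R,\infty)$ for some $R>0$. "Radial" means depending only on $|x|$; "nontrivial" means not identically zero. *)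

theory Defs
  imports
    "HOL-Analysis.Analysis"
    "HOL-Computational_Algebra.Polynomial"
    "HOL-Combinatorics.Permutations"
begin

definition partial :: "'n::finite \<Rightarrow> (real ^ 'n \<Rightarrow> real) \<Rightarrow> real ^ 'n \<Rightarrow> real" where
  "partial i u x = frechet_derivative u (at x) (axis i 1)"

definition C2 :: "(real ^ 'n::finite \<Rightarrow> real) \<Rightarrow> bool" where
  "C2 u \<longleftrightarrow> u differentiable_on UNIV \<and>
     (\<forall>i. partial i u differentiable_on UNIV) \<and>
     (\<forall>i j. continuous_on UNIV (partial i (partial j u)))"

definition hessian :: "(real ^ 'n::finite \<Rightarrow> real) \<Rightarrow> real ^ 'n \<Rightarrow> real ^ 'n ^ 'n" where
  "hessian u x = (\<chi> i j. partial i (partial j u) x)"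

definition eigenvalue_vector :: "real ^ 'n ^ 'n \<Rightarrow> real ^ 'n::finite \<Rightarrow> bool" where
  "eigenvalue_vector A l \<longleftrightarrow> (\<forall>t. det (mat t - A) = (\<Prod>i\<in>UNIV. t - l $ i))"

text \<open>The eigenvalues are listed with algebraic multiplicity. Such a vector exists whenever the
  characteristic polynomial splits over the reals, in particular for every symmetric matrix. It
  is unique up to the order of its entries, which is left unspecified; by
  \<open>elem_sym_eigenvalue_vector\<close> below, the order does not affect the symmetric functions.\<close>

definition eigenvalues :: "real ^ 'n ^ 'n \<Rightarrow> real ^ 'n::finite" where
  "eigenvalues A = (SOME l. eigenvalue_vector A l)"

definition elem_sym :: "nat \<Rightarrow> real ^ 'n::finite \<Rightarrow> real" where
  "elem_sym j l = (\<Sum>I | I \<subseteq> UNIV \<and> card I = j. \<Prod>i\<in>I. l $ i)"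

definition garding_cone :: "nat \<Rightarrow> (real ^ 'n::finite) set" where
  "garding_cone k = {l. \<forall>j\<in>{1..k}. elem_sym j l > 0}"

definition admissible :: "nat \<Rightarrow> (real ^ 'n::finite \<Rightarrow> real) set" where
  "admissible k = {u. C2 u \<and> (\<forall>x. eigenvalues (hessian u x) \<in> garding_cone k)}"

lemma eigenvalue_vector_permutes:
  assumes "eigenvalue_vector A l" "eigenvalue_vector A l'"
  obtains q where "q permutes UNIV" "\<And>i. l $ i = l' $ q i"
proof -
  define P where "P = (\<lambda>v::real^'a. \<Prod>i\<in>UNIV. [:- (v $ i), 1:])"
  have ev: "poly (P v) t = (\<Prod>i\<in>UNIV. t - v $ i)" for v t
    by (simp add: P_def poly_prod)
  have "poly (P l) = poly (P l')"
    using assms by (intro ext) (simp add: ev eigenvalue_vector_def)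
  then have eq: "P l = P l'"
    by (simp add: poly_eq_poly_eq_iff)
  have "proots (P v) = image_mset (($) v) (mset_set UNIV)" for v
  proof -
    have "proots (\<Prod>i\<in>I. [:- (v $ i), 1:]) = image_mset (($) v) (mset_set I)"
      if "finite I" for I
      using that
      by (induction I rule: finite_induct)
         (auto simp: proots_mult proots_linear_factor simp del: mult_pCons_left)
    then show ?thesis by (simp add: P_def)
  qed
  with eq have "image_mset (($) l) (mset_set UNIV) = image_mset (($) l') (mset_set UNIV)"
    by metis
  then obtain q where "q permutes UNIV" "\<forall>i\<in>UNIV. l $ i = l' $ q i"
    using image_mset_eq_implies_permutes[of UNIV "($) l" "($) l'"] by auto
  then show ?thesis using that by auto
qed

lemma elem_sym_permutes:
  assumes q: "q permutes UNIV" and l: "\<And>i. l $ i = l' $ q i"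
  shows "elem_sym j l = elem_sym j l'"
proof -
  have inj: "inj q" and surj: "surj q"
    using q by (auto simp: permutes_inj permutes_surj)
  have bij: "bij_betw (image q) {I. I \<subseteq> UNIV \<and> card I = j} {I. I \<subseteq> UNIV \<and> card I = j}"
    using inj surj
    by (intro bij_betw_byWitness[where f' = "vimage q"])
       (auto simp: inj_vimage_image_eq surj_image_vimage_eq card_image card_vimage_inj inj_on_subset)
  have "elem_sym j l' = (\<Sum>I | I \<subseteq> UNIV \<and> card I = j. \<Prod>i\<in>q ` I. l' $ i)"
    unfolding elem_sym_def by (rule sum.reindex_bij_betw[OF bij, symmetric])
  also have "\<dots> = elem_sym j l"
    unfolding elem_sym_def using inj
    by (intro sum.cong refl) (simp add: prod.reindex inj_on_subset l)
  finally show ?thesis by simp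
qed

lemma elem_sym_eigenvalue_vector:
  assumes "eigenvalue_vector A l"
  shows "elem_sym j (eigenvalues A) = elem_sym j l"
proof -
  have "eigenvalue_vector A (eigenvalues A)"
    unfolding eigenvalues_def using assms by (rule someI)
  from eigenvalue_vector_permutes[OF this assms] obtain q
    where "q permutes UNIV" "\<And>i. eigenvalues A $ i = l $ q i" by metis
  then show ?thesis by (rule elem_sym_permutes)
qed

end

theory Submission
  imports Defs
begin

text \<open>
  For \<open>u(x) = v(|x|)\<close> the Hessian is \<open>w I + q e e\<^sup>T\<close> with \<open>e = x / |x|\<close>, \<open>w = v' / r\<close> and \<open>q = r w'\<close>, and
  the equation becomes \<open>w\<^bsup>k\<^esup> = c r\<^bsup>-N\<^esup> \<integral>\<^sub>0\<^bsup>r\<^esup> s\<^bsup>N-1\<^esup> (p h(v))\<^bsup>k\<^esup> ds\<close>. Monotonicity of \<open>h\<close> makes the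
  Picard iterates starting from the constant 1 increasing, and every iterate is a subsolution.
  Multiplying by \<open>r\<^bsup>N/k - 1\<^esup> v'\<close> and using the monotonicity of \<open>r\<^bsup>N + N/k - 2\<^esup> p\<^bsup>k\<^esup>\<close> gives
  \<open>v' / H(v)\<^bsup>1/(k+1)\<^esup> \<le> C r\<^bsup>(k-1)/(k+1)\<^esup> p\<^bsup>k/(k+1)\<^esup>\<close> for large \<open>r\<close>. The right-hand side is integrable by
  AM-GM against \<open>r\<^bsup>-1-\<epsilon>\<^esup>\<close>, so the Keller-Osserman condition bounds all iterates by one constant;
  their limit is the profile of the solution.
\<close>

section \<open>Hessians of radial functions\<close>

text \<open>An orthogonal \<open>Q\<close> with column \<open>i0\<close> equal to \<open>e\<close>
  diagonalizes \<open>w I + q e e^T\<close>. Eigenvalue vectors carry no preferred order, so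
  \<open>i0\<close> is arbitrary.\<close>

lemma eigenvalue_vector_scalar_plus_rank_one:
  fixes e :: "real ^ 'n::finite"
  assumes "norm e = 1"
  shows "eigenvalue_vector (\<chi> i j. (if i = j then w else 0) + q * e $ i * e $ j)
           (\<chi> i. w + (if i = i0 then q else 0))"
proof -
  obtain Q :: "real ^ 'n ^ 'n" where Q: "orthogonal_matrix Q" "Q *v axis i0 1 = e"
    using orthogonal_matrix_exists_basis[OF assms] by metis
  define D :: "real ^ 'n ^ 'n" where "D = (\<chi> i j. if i = j then w + (if i = i0 then q else 0) else 0)"
  have QQ: "Q ** transpose Q = mat 1" and QQ': "transpose Q ** Q = mat 1"
    using Q(1) by (auto simp: orthogonal_matrix_def)
  have col: "Q $ i $ i0 = e $ i" for i
    using Q(2) by (metis column_def matrix_vector_mult_basis vec_lambda_beta)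
  have QDQ: "(\<chi> i j. (if i = j then w else 0) + q * e $ i * e $ j) = Q ** D ** transpose Q"
  proof -
    have "(Q ** D ** transpose Q) $ i $ j = (if i = j then w else 0) + q * e $ i * e $ j" for i j
    proof -
      have "(Q ** D) $ i $ l = Q $ i $ l * (w + (if l = i0 then q else 0))" for l
        by (simp add: matrix_matrix_mult_def D_def if_distrib cong: if_cong)
      then have "(Q ** D ** transpose Q) $ i $ j
          = (\<Sum>l\<in>UNIV. Q $ i $ l * (w + (if l = i0 then q else 0)) * Q $ j $ l)"
        by (subst matrix_matrix_mult_def) (simp add: transpose_def)
      also have "\<dots> = (\<Sum>l\<in>UNIV. w * (Q $ i $ l * Q $ j $ l) +
          (if l = i0 then q * Q $ i $ l * Q $ j $ l else 0))"
        by (intro sum.cong) (auto simp: algebra_simps)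
      also have "\<dots> = w * (Q ** transpose Q) $ i $ j + q * e $ i * e $ j"
        by (simp add: sum.distrib matrix_matrix_mult_def transpose_def col sum_distrib_left)
      finally show ?thesis
        by (simp add: QQ mat_def)
    qed
    then show ?thesis by (simp add: vec_eq_iff)
  qed
  have "det (mat t - Q ** D ** transpose Q) = (\<Prod>i\<in>UNIV. t - (w + (if i = i0 then q else 0)))" for t
  proof -
    have "mat t - Q ** D ** transpose Q = Q ** (mat t - D) ** transpose Q"
    proof -
      have left: "A ** (B - C) = A ** B - A ** C" and right: "(B - C) ** A = B ** A - C ** A"
        for A B C :: "real ^ 'n ^ 'n"
        by (simp_all add: matrix_matrix_mult_def vec_eq_iff algebra_simps sum_subtractf)
      have "Q ** mat t ** transpose Q = mat t"
      proof -
        have "mat t = t *\<^sub>R (mat 1 :: real ^ 'n ^ 'n)"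
          by (simp add: vec_eq_iff mat_def)
        then show ?thesis
          by (metis QQ matrix_mul_rid matrix_scalar_ac scalar_matrix_assoc)
      qed
      then show ?thesis
        by (simp add: left right)
    qed
    then have "det (mat t - Q ** D ** transpose Q) = det (mat t - D) * (det Q * det (transpose Q))"
      by (simp add: det_mul)
    also have "det Q * det (transpose Q) = 1"
      by (metis QQ det_I det_mul)
    also have "det (mat t - D) = (\<Prod>i\<in>UNIV. (mat t - D) $ i $ i)"
      by (rule det_diagonal) (auto simp: mat_def D_def)
    finally show ?thesis
      by (simp add: mat_def D_def)
  qed
  then show ?thesis
    by (simp add: eigenvalue_vector_def QDQ)
qed

text \<open>The index sets are split by whether they contain \<open>i0\<close>; those that do arise
  from \<open>(j - 1)\<close>-subsets of the remaining indices.\<close>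

lemma elem_sym_all_but_one_equal:
  assumes "j \<ge> 1"
  shows "elem_sym j ((\<chi> i. w + (if i = i0 then q else 0)) :: real ^ 'n::finite)
    = real (CARD('n) - 1 choose (j - 1)) * (w + q) * w ^ (j - 1) + real (CARD('n) - 1 choose j) * w ^ j"
proof -
  let ?l = "\<lambda>i::'n. w + (if i = i0 then q else 0)"
  let ?U = "UNIV - {i0}"
  define A where "A = {I. I \<subseteq> ?U \<and> card I = j}"
  define B where "B = {I. I \<subseteq> ?U \<and> card I = j - 1}"
  have inj: "inj_on (insert i0) B"
    unfolding B_def inj_on_def by blast
  have split: "{I. I \<subseteq> UNIV \<and> card I = j} = A \<union> insert i0 ` B"
  proof (intro equalityI subsetI)
    fix I :: "'n set" assume I: "I \<in> {I. I \<subseteq> UNIV \<and> card I = j}"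
    show "I \<in> A \<union> insert i0 ` B"
    proof (cases "i0 \<in> I")
      case True
      then have "I = insert i0 (I - {i0})" "I - {i0} \<in> B"
        using I by (auto simp: B_def)
      then show ?thesis by blast
    qed (use I in \<open>auto simp: A_def\<close>)
  next
    fix I assume "I \<in> A \<union> insert i0 ` B"
    then show "I \<in> {I. I \<subseteq> UNIV \<and> card I = j}"
    proof
      assume "I \<in> insert i0 ` B"
      then obtain J where J: "I = insert i0 J" "J \<in> B" by blast
      then have "i0 \<notin> J" "finite J" by (auto simp: B_def)
      then show ?thesis using J assms by (auto simp: B_def)
    qed (auto simp: A_def)
  qed
  have cA: "card A = (CARD('n) - 1 choose j)" and cB: "card B = (CARD('n) - 1 choose (j - 1))"
    using n_subsets[of ?U j] n_subsets[of ?U "j - 1"] by (simp_all add: A_def B_def card_Diff_singleton)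
  have w: "(\<Prod>i\<in>I. ?l i) = w ^ card I" if "I \<subseteq> ?U" for I
  proof -
    have "(\<Prod>i\<in>I. ?l i) = (\<Prod>i\<in>I. w)"
      using that by (intro prod.cong) auto
    then show ?thesis by simp
  qed
  have "(\<Sum>I\<in>A. \<Prod>i\<in>I. ?l i) = (\<Sum>I\<in>A. w ^ j)"
    by (intro sum.cong) (auto simp: A_def w)
  moreover have "(\<Sum>I\<in>insert i0 ` B. \<Prod>i\<in>I. ?l i) = (\<Sum>I\<in>B. (w + q) * w ^ (j - 1))"
    unfolding sum.reindex[OF inj] o_def
  proof (intro sum.cong refl)
    fix I assume I: "I \<in> B"
    then have "i0 \<notin> I" "finite I" by (auto simp: B_def)
    then show "(\<Prod>i\<in>insert i0 I. ?l i) = (w + q) * w ^ (j - 1)"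
      using I w[of I] by (auto simp: B_def)
  qed
  moreover have "A \<inter> insert i0 ` B = {}"
    by (auto simp: A_def)
  ultimately show ?thesis
    unfolding elem_sym_def split
    by (subst sum.union_disjoint) (auto simp: cA cB)
qed

section \<open>Differentiation of functions of the norm\<close>

lemma partialI:
  assumes "(u has_derivative D) (at x)" "D (axis i 1) = d"
  shows "partial i u x = d"
  using assms by (simp add: partial_def frechet_derivative_at[symmetric])

lemma has_derivative_radial:
  fixes x :: "real ^ 'n::finite"
  assumes "(g has_real_derivative d) (at (norm x))" "x \<noteq> 0"
  shows "((\<lambda>x. g (norm x)) has_derivative (\<lambda>y. d * (x \<bullet> y) / norm x)) (at x)"
proof -
  have "((\<lambda>x. g (norm x)) has_derivative (\<lambda>y. d * (y \<bullet> sgn x))) (at x)"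
    using has_derivative_compose[OF has_derivative_norm[OF assms(2)], of g "\<lambda>z. d * z"] assms(1)
    by (simp add: has_field_derivative_def)
  then show ?thesis
    by (simp add: sgn_div_norm inner_commute divide_inverse mult_ac)
qed

text \<open>Here \<open>q t\<close> stands for \<open>t * w'(t)\<close>, so no derivative of
  \<open>w\<close> at 0 is assumed. Continuity of \<open>w\<close> and \<open>q\<close> with
  \<open>q 0 = 0\<close> gives the regularity of the lift at the origin.\<close>

locale radial_profile =
  fixes v w q :: "real \<Rightarrow> real"
  assumes v_deriv: "\<And>t. t \<ge> 0 \<Longrightarrow> (v has_real_derivative t * w t) (at t within {0..})"
    and w_deriv: "\<And>t. t > 0 \<Longrightarrow> (w has_real_derivative q t / t) (at t)"
    and w_cont: "continuous_on {0..} w"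
    and q_cont: "continuous_on {0..} q"
    and q0: "q 0 = 0"
begin

definition lift :: "real ^ 'n::finite \<Rightarrow> real" where
  "lift x = v (norm x)"

lemma lift_has_derivative:
  fixes x :: "real ^ 'n::finite"
  shows "(lift has_derivative (\<lambda>y. w (norm x) * (x \<bullet> y))) (at x)"
proof (cases "x = 0")
  case False
  then have "(v has_real_derivative norm x * w (norm x)) (at (norm x))"
    using v_deriv[of "norm x"] by (simp add: at_within_interior[of _ "{0..}"])
  from has_derivative_radial[OF this False] False show ?thesis
    by (simp add: lift_def[abs_def])
next
  case True
  \<comment> \<open>The norm is not differentiable at 0, but the one-sided derivative of
    \<open>v\<close> vanishes there, and this estimate transfers directly with
    \<open>r = norm y\<close>.\<close>
  have "(v has_derivative (\<lambda>_. 0)) (at 0 within {0..})"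
    using v_deriv[of 0] by (simp add: has_field_derivative_def lambda_zero)
  then have *: "\<forall>e>0. \<exists>d>0. \<forall>r\<in>{0..}. norm (r - 0) < d \<longrightarrow> norm (v r - v 0 - 0) \<le> e * norm (r - 0)"
    unfolding has_derivative_within_alt by blast
  have "(lift has_derivative (\<lambda>_. 0)) (at (0 :: real ^ 'n))"
    unfolding has_derivative_at_alt
  proof (intro conjI allI impI bounded_linear_zero)
    fix e :: real assume "e > 0"
    then obtain d where "d > 0"
      and *: "\<forall>r\<in>{0..}. norm (r - 0) < d \<longrightarrow> norm (v r - v 0 - 0) \<le> e * norm (r - 0)"
      using * by blast
    then have d: "d > 0" "\<And>r. r \<ge> 0 \<Longrightarrow> r < d \<Longrightarrow> \<bar>v r - v 0\<bar> \<le> e * r"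
      using *[THEN bspec] by force+
    show "\<exists>d>0. \<forall>y::real ^ 'n. norm (y - 0) < d \<longrightarrow> norm (lift y - lift 0 - 0) \<le> e * norm (y - 0)"
      using d by (intro exI[of _ d]) (auto simp: lift_def)
  qed
  then show ?thesis by (simp add: True)
qed

lemma partial_lift: "partial i lift = (\<lambda>x. w (norm x) * x $ i)"
  by (rule ext, rule partialI[OF lift_has_derivative]) (simp add: inner_axis)

text \<open>Division by zero gives the value 0 at the origin. The coefficient may be unbounded
  nearby; its product with \<open>x $ i * x $ j\<close> is at most
  \<open>\<bar>q (norm x)\<bar>\<close> in absolute value.\<close>

definition hess_coeff :: "real ^ 'n::finite \<Rightarrow> real" where
  "hess_coeff x = q (norm x) / (norm x)\<^sup>2"

lemma partial_lift_has_derivative: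
  fixes x :: "real ^ 'n::finite"
  shows "((\<lambda>x. w (norm x) * x $ i) has_derivative
     (\<lambda>y. w (norm x) * y $ i + hess_coeff x * (x \<bullet> y) * x $ i)) (at x)"
proof (cases "x = 0")
  case False
  have "((\<lambda>x. w (norm x)) has_derivative (\<lambda>y. q (norm x) / norm x * (x \<bullet> y) / norm x)) (at x)"
    using False by (intro has_derivative_radial w_deriv) auto
  then have "((\<lambda>x. w (norm x) * x $ i) has_derivative
      (\<lambda>y. w (norm x) * y $ i + (q (norm x) / norm x * (x \<bullet> y) / norm x) * x $ i)) (at x)"
    by (intro has_derivative_mult bounded_linear.has_derivative[OF bounded_linear_vec_nth]
          has_derivative_ident)
  then show ?thesis
    by (simp add: hess_coeff_def power2_eq_square mult_ac)
next
  case True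
  \<comment> \<open>Since the factor \<open>x $ i\<close> vanishes at the origin, continuity of
    \<open>w\<close> replaces the product rule.\<close>
  have "((\<lambda>x. w (norm x) * x $ i) has_derivative (\<lambda>y. w 0 * y $ i)) (at (0 :: real ^ 'n))"
    unfolding has_derivative_at_alt
  proof (intro conjI allI impI)
    show "bounded_linear (\<lambda>y::real ^ 'n. w 0 * y $ i)"
      by (intro bounded_linear_intros bounded_linear_vec_nth)
    fix e :: real assume "e > 0"
    then obtain d where "d > 0" and *: "\<forall>r\<in>{0..}. dist r 0 < d \<longrightarrow> dist (w r) (w 0) < e"
      using w_cont unfolding continuous_on_iff by (meson atLeast_iff order_refl)
    then have d: "d > 0" "\<And>r. r \<ge> 0 \<Longrightarrow> r < d \<Longrightarrow> \<bar>w r - w 0\<bar> < e"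
      using *[THEN bspec] by (force simp: dist_real_def)+
    have "\<bar>w (norm y) * y $ i - w 0 * y $ i\<bar> \<le> e * norm y" if "norm y < d" for y :: "real ^ 'n"
    proof -
      have "\<bar>w (norm y) * y $ i - w 0 * y $ i\<bar> = \<bar>w (norm y) - w 0\<bar> * \<bar>y $ i\<bar>"
        by (simp add: left_diff_distrib flip: abs_mult)
      also have "\<dots> \<le> e * norm y"
        using d(2)[of "norm y"] that component_le_norm_cart[of y i] by (intro mult_mono) auto
      finally show ?thesis .
    qed
    then show "\<exists>d>0. \<forall>y::real ^ 'n. norm (y - 0) < d \<longrightarrow>
        norm (w (norm y) * y $ i - w (norm 0) * 0 $ i - w 0 * (y - 0) $ i) \<le> e * norm (y - 0)"
      using d(1) by (intro exI[of _ d]) auto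
  qed
  then show ?thesis by (simp add: True)
qed

lemma partial_partial_lift:
  "partial i (partial j lift) =
     (\<lambda>x. (if i = j then w (norm x) else 0) + hess_coeff x * x $ i * x $ j)"
proof -
  have "axis i (1::real) $ j = (if i = j then 1 else 0)"
    by (simp add: axis_def)
  then show ?thesis
    unfolding partial_lift
    by (intro ext partialI[OF partial_lift_has_derivative]) (simp add: inner_axis)
qed

lemma C2_lift: "C2 (lift :: real ^ 'n::finite \<Rightarrow> real)"
  unfolding C2_def
proof (intro conjI allI)
  show "(lift :: real ^ 'n \<Rightarrow> real) differentiable_on UNIV"
    using lift_has_derivative by (auto simp: differentiable_on_def differentiable_def)
  fix i j :: 'n
  show "partial i lift differentiable_on UNIV"
    using partial_lift_has_derivative unfolding partial_lift
    by (auto simp: differentiable_on_def differentiable_def)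
  have wn: "continuous_on UNIV (\<lambda>x::real ^ 'n. w (norm x))"
    and qn: "continuous_on UNIV (\<lambda>x::real ^ 'n. q (norm x))"
    by (auto intro!: continuous_on_compose2[OF w_cont] continuous_on_compose2[OF q_cont]
          continuous_intros)
  have "isCont (\<lambda>x::real ^ 'n. hess_coeff x * x $ i * x $ j) x" for x :: "real ^ 'n"
  proof (cases "x = 0")
    case False
    then show ?thesis
      using qn unfolding hess_coeff_def
      by (intro continuous_intros) (auto simp: continuous_on_eq_continuous_at)
  next
    case True
    have "((\<lambda>x::real ^ 'n. hess_coeff x * x $ i * x $ j) \<longlongrightarrow> 0) (at 0)"
    proof (rule Lim_null_comparison)
      show "((\<lambda>x::real ^ 'n. \<bar>q (norm x)\<bar>) \<longlongrightarrow> 0) (at 0)"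
        using qn q0 by (auto simp: continuous_on_eq_continuous_at isCont_def intro!: tendsto_eq_intros)
      have "norm (hess_coeff x * x $ i * x $ j) \<le> \<bar>q (norm x)\<bar>" for x :: "real ^ 'n"
      proof (cases "x = 0")
        case False
        have "\<bar>x $ i\<bar> * \<bar>x $ j\<bar> \<le> (norm x)\<^sup>2"
          unfolding power2_eq_square by (intro mult_mono component_le_norm_cart) auto
        then have "\<bar>q (norm x)\<bar> * (\<bar>x $ i\<bar> * \<bar>x $ j\<bar>) / (norm x)\<^sup>2 \<le> \<bar>q (norm x)\<bar>"
          using False by (simp add: divide_le_eq mult_left_mono)
        then show ?thesis
          by (simp add: hess_coeff_def abs_mult)
      qed (simp add: hess_coeff_def)
      then show "\<forall>\<^sub>F x::real ^ 'n in at 0. norm (hess_coeff x * x $ i * x $ j) \<le> \<bar>q (norm x)\<bar>"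
        by simp
    qed
    then show ?thesis by (simp add: True isCont_def)
  qed
  then have "continuous_on UNIV (\<lambda>x::real ^ 'n. hess_coeff x * x $ i * x $ j)"
    by (simp add: continuous_on_eq_continuous_at)
  with wn show "continuous_on UNIV (partial i (partial j (lift :: real ^ 'n \<Rightarrow> real)))"
    unfolding partial_partial_lift by (cases "i = j") (auto intro!: continuous_intros)
qed

end

lemma (in radial_profile) eigenvalue_vector_hessian_lift:
  fixes x :: "real ^ 'n::finite"
  shows "eigenvalue_vector (hessian lift x)
    (\<chi> i. w (norm x) + (if i = i0 then q (norm x) else 0))"
proof -
  \<comment> \<open>At the origin any unit vector can serve as radial direction, because
    \<open>q 0 = 0\<close> removes the rank-one term.\<close>
  define d where "d = (if x = 0 then axis i0 1 else x /\<^sub>R norm x)"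
  have "norm d = 1"
    by (simp add: d_def)
  moreover have "hess_coeff x * x $ i * x $ j = q (norm x) * d $ i * d $ j" for i j
    by (simp add: d_def hess_coeff_def q0 power2_eq_square divide_simps)
  then have "hessian lift x = (\<chi> i j. (if i = j then w (norm x) else 0) + q (norm x) * d $ i * d $ j)"
    by (simp add: hessian_def partial_partial_lift)
  ultimately show ?thesis
    by (simp add: eigenvalue_vector_scalar_plus_rank_one)
qed

section \<open>Weighted averages and integrals\<close>

text \<open>This is \<open>t\<^bsup>-N\<^esup> \<integral>\<^sub>0\<^bsup>t\<^esup> s\<^bsup>N-1\<^esup> f(s) ds\<close>, rescaled to the unit interval so that it is
  meaningful and continuous at \<open>t = 0\<close>.\<close>

definition avg :: "nat \<Rightarrow> (real \<Rightarrow> real) \<Rightarrow> real \<Rightarrow> real" where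
  "avg N f t = integral {0..1} (\<lambda>\<sigma>. \<sigma> ^ (N - 1) * f (t * \<sigma>))"

lemma avg_integrand_continuous:
  fixes f :: "real \<Rightarrow> real"
  assumes "continuous_on {0..} f" "t \<ge> 0"
  shows "continuous_on {0..1} (\<lambda>\<sigma>. \<sigma> ^ (N - 1) * f (t * \<sigma>))"
  by (intro continuous_intros continuous_on_compose2[OF assms(1)]) (use assms(2) in auto)

lemma continuous_on_avg:
  assumes "continuous_on {0..} f"
  shows "continuous_on {0..} (avg N f)"
proof -
  have "continuous_on ({0..} \<times> cbox 0 1) (\<lambda>(t, \<sigma>). \<sigma> ^ (N - 1) * f (t * \<sigma>))"
    unfolding case_prod_unfold
    by (intro continuous_intros continuous_on_compose2[OF assms]) auto
  then show ?thesis
    using integral_continuous_on_param[of "{0::real..}" 0 1 "\<lambda>t \<sigma>. \<sigma> ^ (N - 1) * f (t * \<sigma>)"]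
    by (simp add: avg_def[abs_def])
qed

lemma avg_const:
  assumes "N \<ge> 1"
  shows "avg N (\<lambda>_. C) t = C / real N"
proof -
  have "((\<lambda>\<sigma>. \<sigma> ^ (N - 1) * C) has_integral (1 ^ N * C / N - 0 ^ N * C / N)) {0..1::real}"
    using assms
    by (intro fundamental_theorem_of_calculus)
       (auto simp: has_real_derivative_iff_has_vector_derivative[symmetric] field_simps
             intro!: derivative_eq_intros)
  then show ?thesis
    using assms unfolding avg_def by (subst integral_unique) (auto simp: zero_power)
qed

lemma avg_at_0:
  assumes "N \<ge> 1"
  shows "avg N f 0 = f 0 / real N"
  using avg_const[OF assms, of "f 0" 0] by (simp add: avg_def)

lemma avg_mono:
  assumes "continuous_on {0..} f" "continuous_on {0..} g" "t \<ge> 0"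
    and "\<And>s. 0 \<le> s \<Longrightarrow> s \<le> t \<Longrightarrow> f s \<le> g s"
  shows "avg N f t \<le> avg N g t"
  unfolding avg_def
  by (intro integral_le integrable_continuous_interval avg_integrand_continuous assms
        mult_left_mono) (use assms(3) in \<open>auto intro: mult_left_le\<close>)

lemma avg_eq_integral:
  assumes "continuous_on {0..} f" "t > 0" "N \<ge> 1"
  shows "t ^ N * avg N f t = integral {0..t} (\<lambda>s. s ^ (N - 1) * f s)"
proof -
  have "((\<lambda>s. s ^ (N - 1) * f s) has_integral integral {0..t} (\<lambda>s. s ^ (N - 1) * f s)) {0..t}"
    by (intro integrable_integral integrable_continuous_interval continuous_intros
          continuous_on_subset[OF assms(1)]) auto
  from has_integral_stretch_real[OF this, of t] assms(2)
  have "((\<lambda>\<sigma>. t ^ (N - 1) * (\<sigma> ^ (N - 1) * f (t * \<sigma>))) has_integral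
      integral {0..t} (\<lambda>s. s ^ (N - 1) * f s) / t) {0..1}"
    by (simp add: power_mult_distrib mult_ac image_divide_atLeastAtMost)
  then have "t ^ (N - 1) * avg N f t = integral {0..t} (\<lambda>s. s ^ (N - 1) * f s) / t"
    by (simp add: avg_def integral_unique flip: integral_mult_right)
  moreover have "t ^ N = t ^ (N - 1) * t"
    using assms(3) by (metis Suc_diff_1 less_eq_Suc_le One_nat_def power_Suc2)
  ultimately show ?thesis
    using assms(2) by (simp add: field_simps)
qed

lemma DERIV_power_avg:
  assumes "continuous_on {0..} f" "t > 0" "N \<ge> 1"
  shows "((\<lambda>t. t ^ N * avg N f t) has_real_derivative t ^ (N - 1) * f t) (at t)"
proof -
  have "((\<lambda>t. integral {0..t} (\<lambda>s. s ^ (N - 1) * f s)) has_real_derivative t ^ (N - 1) * f t)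
      (at t within {0..t + 1})"
    using assms(2)
    by (intro integral_has_real_derivative continuous_intros continuous_on_subset[OF assms(1)]) auto
  then have "((\<lambda>t. integral {0..t} (\<lambda>s. s ^ (N - 1) * f s)) has_real_derivative t ^ (N - 1) * f t)
      (at t)"
    using assms(2) by (simp add: at_within_Icc_at)
  then show ?thesis
    by (rule has_field_derivative_transform_within_open[of _ _ _ "{0<..}"])
       (use assms in \<open>auto simp: avg_eq_integral\<close>)
qed

text \<open>The quotient rule for \<open>(t ^ N * avg N f t) / t ^ N\<close> avoids differentiating
  \<open>f\<close> under the integral sign.\<close>

lemma DERIV_avg:
  assumes "continuous_on {0..} f" "t > 0" "N \<ge> 1"
  shows "(avg N f has_real_derivative (f t - real N * avg N f t) / t) (at t)"
proof -
  have tN: "t ^ N = t * t ^ (N - 1)"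
    using assms(3) by (metis Suc_diff_1 less_eq_Suc_le One_nat_def power_Suc)
  have "((\<lambda>t. (t ^ N * avg N f t) / t ^ N) has_real_derivative
      (t ^ (N - 1) * f t * t ^ N - t ^ N * avg N f t * (real N * t ^ (N - 1))) / (t ^ N * t ^ N)) (at t)"
    using assms DERIV_power_avg[OF assms]
    by (intro DERIV_divide DERIV_cong[OF DERIV_pow[of N t UNIV]]) auto
  also have "(t ^ (N - 1) * f t * t ^ N - t ^ N * avg N f t * (real N * t ^ (N - 1))) / (t ^ N * t ^ N)
      = (f t - real N * avg N f t) / t"
    using assms(2) unfolding tN by (simp add: divide_simps) (simp add: algebra_simps)
  finally show ?thesis
    by (rule has_field_derivative_transform_within_open[of _ _ _ "{0<..}"]) (use assms in auto)
qed

section \<open>Nonnegative integrals and a binomial identity\<close>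

lemma set_nn_integral_Icc_eq_integral:
  fixes f :: "real \<Rightarrow> real"
  assumes "continuous_on {a..b} f" "\<And>t. t \<in> {a..b} \<Longrightarrow> f t \<ge> 0"
  shows "(\<integral>\<^sup>+t\<in>{a..b}. ennreal (f t) \<partial>lborel) = ennreal (integral {a..b} f)"
  by (intro nn_integral_has_integral_lebesgue' integrable_integral integrable_continuous_interval assms)

text \<open>Monotone convergence along \<open>{a..a + real n}\<close>. Read contrapositively, an
  infinite integral forces unbounded integrals over compact intervals, which is how the
  Keller-Osserman condition is used.\<close>

lemma set_nn_integral_atLeast_le:
  fixes f :: "real \<Rightarrow> real"
  assumes "continuous_on {a..} f" "\<And>t. t \<ge> a \<Longrightarrow> f t \<ge> 0"
    and "\<And>b. b \<ge> a \<Longrightarrow> integral {a..b} f \<le> L"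
  shows "(\<integral>\<^sup>+t\<in>{a..}. ennreal (f t) \<partial>lborel) \<le> ennreal L"
proof -
  define g where "g = (\<lambda>n t. ennreal (f t) * indicator {a..a + real n} t)"
  have cont: "continuous_on {a..b} f" for b
    by (rule continuous_on_subset[OF assms(1)]) auto
  have SUP: "(SUP n. g n t) = ennreal (f t) * indicator {a..} t" for t
  proof (rule antisym)
    show "(SUP n. g n t) \<le> ennreal (f t) * indicator {a..} t"
      by (intro SUP_least) (auto simp: g_def indicator_def)
    obtain n where "t \<le> a + real n"
      using real_arch_simple[of "t - a"] by (auto simp: algebra_simps)
    then have "ennreal (f t) * indicator {a..} t = g n t"
      by (auto simp: g_def indicator_def)
    then show "ennreal (f t) * indicator {a..} t \<le> (SUP n. g n t)"
      by (auto intro: SUP_upper)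
  qed
  have "(\<integral>\<^sup>+t\<in>{a..}. ennreal (f t) \<partial>lborel) = (\<integral>\<^sup>+t. (SUP n. g n t) \<partial>lborel)"
    by (simp add: SUP)
  also have "\<dots> = (SUP n. \<integral>\<^sup>+t. g n t \<partial>lborel)"
  proof (rule nn_integral_monotone_convergence_SUP)
    show "incseq g"
      by (auto simp: incseq_def le_fun_def g_def indicator_def)
    have "(\<lambda>t. ennreal (indicator {a..a + real n} t * f t)) \<in> borel_measurable borel" for n
      using borel_measurable_continuous_on_indicator[OF _ cont] by (simp add: scaleR_conv_of_real)
    moreover have "g n = (\<lambda>t. ennreal (indicator {a..a + real n} t * f t))" for n
      by (auto simp: g_def indicator_def)
    ultimately show "g n \<in> borel_measurable lborel" for n by simp
  qed
  also have "\<dots> \<le> ennreal L"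
    unfolding g_def
    by (intro SUP_least, subst set_nn_integral_Icc_eq_integral[OF cont])
       (use assms in \<open>auto intro!: ennreal_leI\<close>)
  finally show ?thesis .
qed

text \<open>This lets both binomials in the \<open>j\<close>-th symmetric function share one factor.
  For \<open>j = N\<close> both sides are 0.\<close>

lemma times_binomial_eq:
  assumes "1 \<le> j" "j \<le> N"
  shows "real j * real (N - 1 choose j) = (real N - real j) * real (N - 1 choose (j - 1))"
proof (cases "j = N")
  case False
  then obtain a b where "j = Suc a" "N - 1 = Suc (a + b)"
    using assms by (metis Suc_diff_1 add_Suc le_add_diff_inverse less_eq_Suc_le less_imp_Suc_add One_nat_def le_neq_implies_less diff_Suc_1)
  moreover from this have "real N - real j = real (Suc b)"
    using assms by auto
  moreover have "real (Suc a * (Suc (a + b) choose Suc a)) = real (Suc b * (Suc (a + b) choose a))"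
    by (simp only: Suc_times_binomial_add)
  ultimately show ?thesis
    by (simp only: of_nat_mult diff_Suc_1)
qed (use assms in simp)

section \<open>The radial equation\<close>

lemma avg_pos:
  assumes "continuous_on {0..} f" "t \<ge> 0" "N \<ge> 1" "\<And>s. s \<ge> 0 \<Longrightarrow> f s > 0"
  shows "avg N f t > 0"
proof -
  have "continuous_on {0..t} f"
    by (rule continuous_on_subset[OF assms(1)]) auto
  then obtain m where m: "m \<in> {0..t}" "\<And>s. s \<in> {0..t} \<Longrightarrow> f m \<le> f s"
    using continuous_attains_inf[of "{0..t}" f] assms(2) by fastforce
  have "0 < f m / real N"
    using assms(3,4) m(1) by simp
  also have "\<dots> = avg N (\<lambda>_. f m) t"
    using assms(3) by (simp add: avg_const)
  also have "\<dots> \<le> avg N f t"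
    using assms m by (intro avg_mono) auto
  finally show ?thesis .
qed

lemma at_within_atLeast_eq_Icc:
  fixes a b t :: real
  assumes "a \<le> t" "t < b"
  shows "at t within {a..} = at t within {a..b}"
  by (rule at_within_nhd[of t "{..<b}"]) (use assms in auto)

lemma has_real_derivative_integral_atLeast:
  fixes f :: "real \<Rightarrow> real"
  assumes "continuous_on {a..} f" "t \<ge> a"
  shows "((\<lambda>t. integral {a..t} f) has_real_derivative f t) (at t within {a..})"
proof -
  have "((\<lambda>t. integral {a..t} f) has_real_derivative f t) (at t within {a..t + 1})"
    using assms by (intro integral_has_real_derivative continuous_on_subset[OF assms(1)]) auto
  then show ?thesis
    using assms by (simp add: at_within_atLeast_eq_Icc[of a t "t + 1"])
qed

locale radial_ode =
  fixes p h :: "real \<Rightarrow> real" and N k :: nat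
  assumes k1: "k \<ge> 1" and kN: "k \<le> N"
    and p_cont: "continuous_on {0..} p" and p_pos: "\<And>r. r \<ge> 0 \<Longrightarrow> p r > 0"
    and h_cont: "continuous_on {0..} h" and h_mono: "mono_on {0..} h"
    and h_pos: "\<And>s. s > 0 \<Longrightarrow> h s > 0"
begin

lemma N1: "N \<ge> 1" using k1 kN by simp

text \<open>For a radial Hessian with \<open>w = v' / t\<close>,
  \<open>(t^N w^k)' = c t^(N-1) S_k\<close>; hence \<open>S_k = src v\<close> integrates to
  \<open>w^k = c * avg N (src v)\<close>.\<close>

definition c :: real where "c = real k / real (N - 1 choose (k - 1))"

lemma c_pos: "c > 0"
  using k1 kN by (auto simp: c_def)

definition src :: "(real \<Rightarrow> real) \<Rightarrow> real \<Rightarrow> real" where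
  "src v s = (p s * h (v s)) ^ k"

text \<open>For a solution \<open>v\<close>, \<open>slope v t\<close> is \<open>v'(t) / t\<close> and \<open>curv v t\<close> is \<open>t (v'(t) / t)'\<close>, so the Hessian
  of \<open>v(|x|)\<close> has the eigenvalue \<open>slope + curv\<close> in the radial direction and \<open>slope\<close> in all others.\<close>

definition slope :: "(real \<Rightarrow> real) \<Rightarrow> real \<Rightarrow> real" where
  "slope v t = root k (c * avg N (src v) t)"

definition curv :: "(real \<Rightarrow> real) \<Rightarrow> real \<Rightarrow> real" where
  "curv v t = (c * src v t - real N * slope v t ^ k) / (real k * slope v t ^ (k - 1))"

text \<open>Fixed points solve the radial equation with initial value 1, integrated twice.\<close>

definition picard :: "(real \<Rightarrow> real) \<Rightarrow> real \<Rightarrow> real" where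
  "picard v r = 1 + integral {0..r} (\<lambda>t. t * slope v t)"

text \<open>The lower bound 1 keeps \<open>h (v t)\<close> and therefore \<open>slope v t\<close>
  positive, so the root is differentiable and the denominator in \<open>curv\<close> is
  nonzero.\<close>

definition profile :: "(real \<Rightarrow> real) \<Rightarrow> bool" where
  "profile v \<longleftrightarrow> continuous_on {0..} v \<and> (\<forall>t\<ge>0. v t \<ge> 1)"

definition H :: "real \<Rightarrow> real" where
  "H t = integral {0..t} (\<lambda>z. h z ^ k)"

lemma continuous_on_src: "profile v \<Longrightarrow> continuous_on {0..} (src v)"
  unfolding src_def[abs_def] profile_def
  by (intro continuous_intros p_cont continuous_on_compose2[OF h_cont]) force+

lemma src_pos: "profile v \<Longrightarrow> t \<ge> 0 \<Longrightarrow> src v t > 0"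
  unfolding src_def profile_def
  by (intro zero_less_power mult_pos_pos p_pos h_pos) (auto dest: spec[of _ t])

lemma avg_src_pos: "profile v \<Longrightarrow> t \<ge> 0 \<Longrightarrow> avg N (src v) t > 0"
  by (intro avg_pos continuous_on_src N1 src_pos)

lemma slope_pos: "profile v \<Longrightarrow> t \<ge> 0 \<Longrightarrow> slope v t > 0"
  unfolding slope_def using avg_src_pos c_pos k1 by simp

lemma slope_power: "profile v \<Longrightarrow> t \<ge> 0 \<Longrightarrow> slope v t ^ k = c * avg N (src v) t"
  unfolding slope_def using avg_src_pos[of v t] c_pos k1 by (simp add: real_root_pow_pos)

lemma continuous_on_slope: "profile v \<Longrightarrow> continuous_on {0..} (slope v)"
  unfolding slope_def[abs_def] by (intro continuous_intros continuous_on_avg continuous_on_src)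

lemma DERIV_slope:
  assumes "profile v" "t > 0"
  shows "(slope v has_real_derivative curv v t / t) (at t)"
proof -
  have "((\<lambda>t. c * avg N (src v) t) has_real_derivative c * ((src v t - N * avg N (src v) t) / t)) (at t)"
    by (intro DERIV_cmult DERIV_avg continuous_on_src assms N1)
  moreover have "0 < c * avg N (src v) t"
    using assms avg_src_pos c_pos by simp
  ultimately have "(slope v has_real_derivative
      inverse (real k * slope v t ^ (k - Suc 0)) * (c * ((src v t - N * avg N (src v) t) / t))) (at t)"
    unfolding slope_def[abs_def] using k1 by (intro DERIV_chain2[OF DERIV_real_root]) auto
  also have "inverse (real k * slope v t ^ (k - Suc 0)) * (c * ((src v t - N * avg N (src v) t) / t))
      = curv v t / t"
    using slope_power[of v t] assms by (simp add: curv_def divide_inverse algebra_simps)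
  finally show ?thesis .
qed

text \<open>By \<open>avg_at_0\<close>, \<open>slope v 0 ^ k = c * src v 0 / N\<close>, so the
  numerator cancels. This supplies \<open>q0\<close> of \<open>radial_profile\<close>.\<close>

lemma curv_0: "profile v \<Longrightarrow> curv v 0 = 0"
  using N1 by (simp add: curv_def slope_power avg_at_0)

lemma continuous_on_curv: "profile v \<Longrightarrow> continuous_on {0..} (curv v)"
  unfolding curv_def[abs_def]
  by (intro continuous_intros continuous_on_src continuous_on_slope) (use k1 slope_pos in fastforce)+

lemma DERIV_picard:
  assumes "profile v" "t \<ge> 0"
  shows "(picard v has_real_derivative t * slope v t) (at t within {0..})"
proof -
  have "((\<lambda>r. integral {0..r} (\<lambda>t. t * slope v t)) has_real_derivative t * slope v t) (at t within {0..})"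
    using assms by (intro has_real_derivative_integral_atLeast continuous_intros continuous_on_slope)
  from DERIV_add[OF DERIV_const[of 1] this] show ?thesis
    by (simp add: picard_def[abs_def])
qed

lemma DERIV_picard_at:
  assumes "profile v" "t > 0"
  shows "(picard v has_real_derivative t * slope v t) (at t)"
  using DERIV_picard[of v t] assms by (simp add: at_within_interior[of t "{0..}"])

section \<open>Order preservation of the Picard map\<close>

lemma slope_mono:
  assumes "profile v" "profile v'" "\<And>s. s \<ge> 0 \<Longrightarrow> v s \<le> v' s" "t \<ge> 0"
  shows "slope v t \<le> slope v' t"
proof -
  have "src v s \<le> src v' s" if "s \<ge> 0" for s
  proof -
    have "1 \<le> v s" "1 \<le> v' s"
      using assms(1,2) that by (auto simp: profile_def)
    then show ?thesis
      unfolding src_def using that assms(3) p_pos[of s] h_pos[of "v s"]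
      by (intro power_mono mult_left_mono mono_onD[OF h_mono] mult_nonneg_nonneg) auto
  qed
  then show ?thesis
    unfolding slope_def using assms c_pos k1
    by (intro real_root_le_mono mult_left_mono avg_mono continuous_on_src) auto
qed

lemma integrable_picard: "profile v \<Longrightarrow> (\<lambda>t. t * slope v t) integrable_on {0..r}"
  by (intro integrable_continuous_interval continuous_intros
        continuous_on_subset[OF continuous_on_slope]) auto

lemma profile_picard:
  assumes "profile v"
  shows "profile (picard v)"
  unfolding profile_def
proof (intro conjI allI impI)
  show "continuous_on {0..} (picard v)"
    using DERIV_picard[OF assms] by (intro DERIV_continuous_on[of _ _ "\<lambda>t. t * slope v t"]) auto
  have "0 \<le> integral {0..t} (\<lambda>t. t * slope v t)" for t
    using slope_pos[OF assms]
    by (intro integral_nonneg integrable_picard[OF assms]) (simp add: less_imp_le)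
  then show "1 \<le> picard v t" for t
    by (simp add: picard_def)
qed

lemma picard_mono:
  assumes "profile v" "profile v'" "\<And>s. s \<ge> 0 \<Longrightarrow> v s \<le> v' s"
  shows "picard v r \<le> picard v' r"
  unfolding picard_def
  by (intro add_left_mono integral_le integrable_picard assms mult_left_mono slope_mono) auto

section \<open>The primitive \<open>H\<close> and the energy inequality\<close>

lemma DERIV_H:
  assumes "t > 0"
  shows "(H has_real_derivative h t ^ k) (at t)"
proof -
  have "(H has_real_derivative h t ^ k) (at t within {0..})"
    unfolding H_def[abs_def] using assms
    by (intro has_real_derivative_integral_atLeast[where f = "\<lambda>z. h z ^ k"] continuous_intros h_cont) auto
  then show ?thesis
    using assms by (simp add: at_within_interior[of t "{0..}"])
qed

lemma continuous_on_H: "continuous_on {1..} H"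
  by (intro continuous_at_imp_continuous_on ballI DERIV_isCont[OF DERIV_H]) simp

lemma H_pos:
  assumes "t > 0"
  shows "H t > 0"
proof -
  have "H 0 < H t"
  proof (rule DERIV_pos_imp_increasing_open[OF assms])
    show "\<exists>y. (H has_real_derivative y) (at x) \<and> 0 < y" if "0 < x" for x
      using that h_pos DERIV_H by (intro exI[of _ "h x ^ k"]) auto
    show "continuous_on {0..t} H"
      unfolding H_def[abs_def]
      by (intro indefinite_integral_continuous_1 integrable_continuous_interval continuous_intros
            continuous_on_subset[OF h_cont]) auto
  qed
  then show ?thesis by (simp add: H_def)
qed


text \<open>The exponent of \<open>t powr (N / k) * t ^ (N - 1) / t\<close>, the weight left on
  \<open>src v t\<close> in the energy derivative once \<open>t * slope v t\<close> is factored
  out.\<close>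

definition weight_exp :: real where "weight_exp = real N + real N / real k - 2"

text \<open>Since \<open>Y = (r\<^bsup>N/k - 1\<^esup> v')\<^bsup>k\<^esup>\<close>, this is the radial equation multiplied by
  \<open>r\<^bsup>N/k - 1\<^esup> v'\<close>; \<open>Y\<^bsup>1 + 1/k\<^esup>\<close> is then dominated by the corresponding multiple of
  \<open>H \<circ> v\<close>. The inequality \<open>v \<le> picard v\<close> makes each Picard iterate a subsolution, so the bound
  applies to the iterates before a solution is known to exist.\<close>

lemma energy_estimate:
  assumes v: "profile v" and le: "\<And>s. s \<ge> 0 \<Longrightarrow> v s \<le> picard v s"
    and r: "r > 0" and psi: "\<And>s. 0 < s \<Longrightarrow> s \<le> r \<Longrightarrow> s powr weight_exp * p s ^ k \<le> r powr weight_exp * \<psi>"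
  shows "(r * slope v r) ^ (k + 1)
    \<le> (real k + 1) / real k * c * r ^ (k - 1) * \<psi> * H (picard v r)"
proof -
  define \<beta> where "\<beta> = (real k + 1) / real k"
  define Y where "Y = (\<lambda>t. c * (t ^ N * avg N (src v) t))"
  \<comment> \<open>The coefficient of \<open>H\<close> is frozen at the endpoint \<open>r\<close>.
    Hypothesis \<open>psi\<close> says that it dominates the weight at every earlier point, which
    makes \<open>E\<close> nondecreasing.\<close>
  define E where "E = (\<lambda>t. \<beta> * c * (r powr weight_exp * \<psi>) * H (picard v t) - Y t powr \<beta>)"
  have \<beta>: "\<beta> > 0" "\<beta> - 1 = 1 / real k" "\<beta> = (1 / real k) * real (k + 1)"
    using k1 by (auto simp: \<beta>_def field_simps)
  have V: "profile (picard v)"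
    by (rule profile_picard[OF v])
  have psi0: "r powr weight_exp * \<psi> \<ge> 0"
    using psi[of r] r p_pos[of r] by (meson less_imp_le order_refl order_trans powr_ge_zero
        mult_nonneg_nonneg zero_le_power)
  have Y_pos: "Y t > 0" if "t > 0" for t
    using that avg_src_pos[OF v] c_pos by (simp add: Y_def)
  have Y_root: "Y t powr (1 / real k) = t powr (real N / real k) * slope v t" if "t > 0" for t
  proof -
    have "Y t = t powr real N * slope v t powr real k"
      using that slope_power[OF v, of t] slope_pos[OF v, of t] by (simp add: Y_def powr_realpow)
    then show ?thesis
      using that slope_pos[OF v, of t] k1 by (simp add: powr_mult powr_powr)
  qed
  have "E 0 \<le> E r"
  proof (rule DERIV_nonneg_imp_increasing_open[where f = E and a = 0 and b = r])
    fix t assume t: "0 < t" "t < r"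
    have V1: "picard v t \<ge> 1" using V t by (simp add: profile_def)
    define A where "A = r powr weight_exp * \<psi> * h (picard v t) ^ k"
    define B where "B = t powr (real N / real k) * t ^ (N - 1) / t * src v t"
    have "((\<lambda>t. H (picard v t)) has_real_derivative h (picard v t) ^ k * (t * slope v t)) (at t)"
      by (rule DERIV_chain2[OF DERIV_H DERIV_picard_at]) (use V1 t v in auto)
    moreover have "(Y has_real_derivative c * (t ^ (N - 1) * src v t)) (at t)"
      unfolding Y_def by (intro DERIV_cmult DERIV_power_avg continuous_on_src v t N1)
    then have "((\<lambda>t. Y t powr \<beta>) has_real_derivative
        \<beta> * Y t powr (\<beta> - 1) * (c * (t ^ (N - 1) * src v t))) (at t)"
      using has_real_derivative_powr[OF Y_pos[OF t(1)], of \<beta>] by (rule DERIV_chain2[rotated])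
    ultimately have "(E has_real_derivative
        \<beta> * c * (r powr weight_exp * \<psi>) * (h (picard v t) ^ k * (t * slope v t))
        - \<beta> * Y t powr (\<beta> - 1) * (c * (t ^ (N - 1) * src v t))) (at t)"
      unfolding E_def by (intro DERIV_diff DERIV_cmult)
    \<comment> \<open>Since \<open>\<beta> - 1 = 1 / k\<close>, \<open>Y_root\<close> produces a
      factor \<open>slope v t\<close> in the second term too, and only the sign of
      \<open>A - B\<close> remains.\<close>
    moreover have "\<beta> * c * (r powr weight_exp * \<psi>) * (h (picard v t) ^ k * (t * slope v t))
        - \<beta> * Y t powr (\<beta> - 1) * (c * (t ^ (N - 1) * src v t)) = \<beta> * c * (t * slope v t) * (A - B)"
      using t unfolding \<beta>(2) Y_root[OF t(1)] A_def B_def by (simp add: field_simps)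
    moreover have "B \<le> A"
    proof -
      have te: "t powr (real N / real k) * t ^ (N - 1) / t = t powr weight_exp"
      proof -
        have "t ^ (N - 1) / t = t powr (real N - 2)"
          using t N1 by (simp add: powr_diff of_nat_diff power2_eq_square power_diff flip: powr_realpow)
        then have "t powr (real N / real k) * t ^ (N - 1) / t
            = t powr (real N / real k) * t powr (real N - 2)"
          by (metis times_divide_eq_right)
        also have "\<dots> = t powr weight_exp"
          by (simp add: weight_exp_def algebra_simps flip: powr_add)
        finally show ?thesis .
      qed
      \<comment> \<open>The subsolution inequality enters here: the source contains
        \<open>h (v t)\<close>, while differentiating \<open>H (picard v t)\<close> gives
        \<open>h (picard v t)\<close>.\<close>
      have h: "0 \<le> h (v t)" "h (v t) \<le> h (picard v t)"
        using le[of t] V1 t v h_pos[of "v t"] by (auto simp: profile_def intro!: mono_onD[OF h_mono])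
           (smt (verit))+
      have "B = (t powr weight_exp * p t ^ k) * h (v t) ^ k"
        unfolding B_def te by (simp add: src_def power_mult_distrib)
      also have "\<dots> \<le> A"
        unfolding A_def by (rule mult_mono[OF psi power_mono]) (use t psi0 h in auto)
      finally show ?thesis .
    qed
    moreover have "0 < \<beta> * c * (t * slope v t)"
      using \<beta>(1) c_pos t slope_pos[OF v, of t] by (intro mult_pos_pos) auto
    ultimately show "\<exists>y. (E has_real_derivative y) (at t) \<and> 0 \<le> y"
      by (metis diff_ge_0_iff_ge less_imp_le mult_nonneg_nonneg)
  next
    have "continuous_on {0..r} (\<lambda>t. H (picard v t))"
      by (rule continuous_on_compose2[OF continuous_on_H])
         (use V in \<open>auto simp: profile_def intro: continuous_on_subset\<close>)
    moreover have "continuous_on {0..r} Y"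
      unfolding Y_def
      by (intro continuous_intros continuous_on_subset[OF continuous_on_avg[OF continuous_on_src[OF v]]])
         auto
    then have "continuous_on {0..r} (\<lambda>t. Y t powr \<beta>)"
    proof (rule continuous_on_powr'[OF _ continuous_on_const], intro ballI)
      fix t assume "t \<in> {0..r}"
      then have "Y t \<ge> 0"
        using Y_pos[of t] N1 by (cases "t = 0") (auto simp: Y_def zero_power less_imp_le)
      then show "0 \<le> Y t \<and> (Y t = 0 \<longrightarrow> 0 < \<beta>)"
        using \<beta>(1) by simp
    qed
    ultimately show "continuous_on {0..r} E"
      unfolding E_def by (intro continuous_on_diff continuous_on_mult continuous_on_const)
  qed (use r in simp)
  \<comment> \<open>Because \<open>picard v 0 = 1\<close> and \<open>Y 0 = 0\<close>, the value
    \<open>E 0\<close> is a nonnegative multiple of \<open>H 1\<close>.\<close>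
  moreover have "0 \<le> E 0"
    using psi0 \<beta> c_pos H_pos[of 1] N1 by (simp add: E_def Y_def picard_def zero_power)
  ultimately have "Y r powr \<beta> \<le> \<beta> * c * (r powr weight_exp * \<psi>) * H (picard v r)"
    by (simp add: E_def)
  moreover have "Y r powr \<beta> = (r powr (real N / real k) * slope v r) ^ (k + 1)"
  proof -
    have "Y r powr \<beta> = (Y r powr (1 / real k)) powr real (k + 1)"
      unfolding \<beta>(3) by (rule powr_powr[symmetric])
    also have "\<dots> = (Y r powr (1 / real k)) ^ (k + 1)"
      using Y_pos[OF r] by (intro powr_realpow) simp
    finally show ?thesis
      unfolding Y_root[OF r] .
  qed
  ultimately have main: "(r powr (real N / real k) * slope v r) ^ (k + 1) * r ^ (k + 1)
      \<le> \<beta> * c * (r powr weight_exp * \<psi>) * H (picard v r) * r ^ (k + 1)"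
    using r by (intro mult_right_mono) auto
  \<comment> \<open>As \<open>weight_exp + (k + 1) = (N / k) (k + 1) + (k - 1)\<close>, multiplying
    by \<open>r ^ (k + 1)\<close> creates a common factor whose cancellation leaves
    \<open>r ^ (k - 1)\<close>.\<close>
  have exponents: "r powr weight_exp * r ^ (k + 1) = (r powr (real N / real k)) ^ (k + 1) * r ^ (k - 1)"
  proof -
    have "r powr weight_exp * r ^ (k + 1) = r powr (weight_exp + real (k + 1))"
      using r by (simp add: powr_add powr_realpow flip: powr_realpow)
    also have "weight_exp + real (k + 1) = real N / real k * real (k + 1) + real (k - 1)"
      using k1 by (simp add: weight_exp_def field_simps of_nat_diff)
    also have "r powr \<dots> = (r powr (real N / real k)) ^ (k + 1) * r ^ (k - 1)"
      using r by (simp only: powr_add powr_realpow[of "r powr _", symmetric] powr_powr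
          powr_realpow[OF r] zero_less_power powr_gt_zero)
    finally show ?thesis .
  qed
  have "(r powr (real N / real k)) ^ (k + 1) * (r * slope v r) ^ (k + 1)
      = (r powr (real N / real k) * slope v r) ^ (k + 1) * r ^ (k + 1)"
    by (simp add: power_mult_distrib mult_ac)
  also note main
  also have "\<beta> * c * (r powr weight_exp * \<psi>) * H (picard v r) * r ^ (k + 1)
      = \<beta> * c * \<psi> * H (picard v r) * (r powr weight_exp * r ^ (k + 1))"
    by (simp only: mult_ac)
  also have "\<dots> = (r powr (real N / real k)) ^ (k + 1) * (\<beta> * c * r ^ (k - 1) * \<psi> * H (picard v r))"
    unfolding exponents by (simp only: mult_ac)
  finally have "(r powr (real N / real k)) ^ (k + 1) * (r * slope v r) ^ (k + 1)
      \<le> (r powr (real N / real k)) ^ (k + 1) * (\<beta> * c * r ^ (k - 1) * \<psi> * H (picard v r))" .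
  moreover have "0 < (r powr (real N / real k)) ^ (k + 1)"
    using r by simp
  ultimately show ?thesis
    unfolding \<beta>_def by (simp only: mult_le_cancel_left_pos)
qed

end

section \<open>A priori bound\<close>

context radial_ode
begin

text \<open>The Keller-Osserman transform. Its base point 1 is the initial value of every
  \<open>picard v\<close>, so \<open>F (picard v 0) = 0\<close>.\<close>

definition F :: "real \<Rightarrow> real" where
  "F s = integral {1..s} (\<lambda>t. 1 / root (k + 1) (real (k + 1) * H t))"

lemma continuous_on_F_integrand: "continuous_on {1..} (\<lambda>t. 1 / root (k + 1) (real (k + 1) * H t))"
proof -
  have "root (k + 1) (real (k + 1) * H t) \<noteq> 0" if "t \<ge> 1" for t
    using H_pos[of t] that by (simp del: of_nat_add of_nat_Suc)
  then show ?thesis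
    by (intro continuous_intros continuous_on_H) auto
qed

lemma F_mono:
  assumes "s \<le> s'"
  shows "F s \<le> F s'"
  unfolding F_def
  by (intro integral_subset_le integrable_continuous_interval
        continuous_on_subset[OF continuous_on_F_integrand])
     (use assms H_pos in \<open>auto intro!: divide_nonneg_nonneg real_root_ge_zero simp: less_imp_le\<close>)

lemma DERIV_F_picard:
  assumes v: "profile v" and t: "t \<ge> 0"
  shows "((\<lambda>t. F (picard v t)) has_real_derivative
    t * slope v t / root (k + 1) (real (k + 1) * H (picard v t))) (at t within {0..})"
proof -
  have V: "picard v t \<ge> 1" if "t \<ge> 0" for t
    using profile_picard[OF v] that by (simp add: profile_def)
  have "(F has_real_derivative 1 / root (k + 1) (real (k + 1) * H (picard v t)))
      (at (picard v t) within picard v ` {0..})"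
    unfolding F_def[abs_def]
    by (rule DERIV_subset[of _ _ _ "{1..}"],
        rule has_real_derivative_integral_atLeast[OF continuous_on_F_integrand]) (use V t in auto)
  from DERIV_image_chain[OF this DERIV_picard[OF v t]] show ?thesis
    by (simp add: o_def)
qed

text \<open>Taking the root of order \<open>k + 1\<close> in \<open>energy_estimate\<close> and
  dividing by the \<open>H\<close> factor bounds the derivative of \<open>F (picard v r)\<close> by
  a quantity independent of \<open>v\<close>.\<close>

lemma slope_estimate:
  assumes v: "profile v" and le: "\<And>s. s \<ge> 0 \<Longrightarrow> v s \<le> picard v s"
    and r: "r > 0" and psi: "\<And>s. 0 < s \<Longrightarrow> s \<le> r \<Longrightarrow> s powr weight_exp * p s ^ k \<le> r powr weight_exp * \<psi>"
  shows "r * slope v r / root (k + 1) (real (k + 1) * H (picard v r))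
    \<le> root (k + 1) (c / real k * r ^ (k - 1) * \<psi>)"
proof -
  have H: "H (picard v r) > 0"
    using profile_picard[OF v] r by (intro H_pos) (auto simp: profile_def dest: spec[of _ r])
  have "r * slope v r = root (k + 1) ((r * slope v r) ^ (k + 1))"
    using r slope_pos[OF v, of r] by (intro real_root_power_cancel[symmetric]) auto
  also have "\<dots> \<le> root (k + 1) ((c / real k * r ^ (k - 1) * \<psi>) * (real (k + 1) * H (picard v r)))"
    using energy_estimate[OF v le r psi] by (intro real_root_le_mono) (auto simp: mult_ac add_ac)
  also have "\<dots> = root (k + 1) (c / real k * r ^ (k - 1) * \<psi>) * root (k + 1) (real (k + 1) * H (picard v r))"
    by (rule real_root_mult)
  finally show ?thesis
    using H by (subst pos_divide_le_eq) (auto simp del: of_nat_add of_nat_Suc)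
qed

text \<open>Integrating \<open>slope_estimate\<close>, separately below and beyond \<open>R\<close>,
  bounds \<open>F (picard v r)\<close> by some \<open>L\<close> independent of \<open>v\<close>. A
  \<open>B\<close> with \<open>F B > L\<close> then bounds \<open>picard v\<close>, since
  \<open>F\<close> is monotone.\<close>

lemma a_priori_bound:
  assumes R: "R > 0" and mono: "mono_on {R..} (\<lambda>r. r powr weight_exp * p r ^ k)"
    and \<epsilon>: "\<epsilon> > 0"
    and I: "\<And>r. r \<ge> R \<Longrightarrow> integral {R..r} (\<lambda>t. t powr (1 + \<epsilon> + 2 * (real k - 1) / (real k + 1))
          * p t powr (2 * real k / (real k + 1))) \<le> I"
    and KO: "\<And>L. \<exists>B\<ge>1. F B > L"
  obtains B where "\<And>v r. profile v \<Longrightarrow> (\<And>s. s \<ge> 0 \<Longrightarrow> v s \<le> picard v s) \<Longrightarrow> r \<ge> 0 \<Longrightarrow> picard v r \<le> B"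
proof -
  define g where "g = (\<lambda>t. t powr (1 + \<epsilon> + 2 * (real k - 1) / (real k + 1))
          * p t powr (2 * real k / (real k + 1)))"
  have g_cont: "continuous_on {R..} g"
    unfolding g_def using R p_pos
    by (intro continuous_intros continuous_on_subset[OF p_cont]) (auto simp: order.strict_iff_order)
  have e0: "weight_exp \<ge> 0"
  proof -
    have "real N / real k \<ge> 1" "real N \<ge> 1"
      using k1 kN N1 by (auto simp: le_divide_eq)
    then show ?thesis unfolding weight_exp_def by simp
  qed
  obtain m where m: "m \<in> {0..R}" "\<And>s. s \<in> {0..R} \<Longrightarrow> p s \<le> p m"
    using continuous_attains_sup[of "{0..R}" p] R continuous_on_subset[OF p_cont, of "{0..R}"] by fastforce
  define M where "M = p m ^ k"
  have M: "p s ^ k \<le> M" if "0 \<le> s" "s \<le> R" for s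
    unfolding M_def using that p_pos[of s] by (intro power_mono m) auto
  have pR: "p R ^ k > 0" using p_pos[of R] R by simp
  have M0: "M > 0" using M[of R] pR R by auto
  \<comment> \<open>\<open>M'\<close> pays for the missing monotonicity below \<open>R\<close>: for
    \<open>s \<le> R\<close>, the weighted \<open>p s ^ k\<close> is at most \<open>M'\<close> times
    its weighted value at \<open>R\<close>.\<close>
  define M' where "M' = M / p R ^ k"
  have M': "M' \<ge> 1" unfolding M'_def using M[of R] pR R by simp
  define C1 where "C1 = root (k + 1) (c / real k * R ^ (k - 1) * M)"
  define C2 where "C2 = root (k + 1) (c / real k * M')"
  have C1: "C1 \<ge> 0" and C2: "C2 \<ge> 0"
    unfolding C1_def C2_def using c_pos M0 M' R by (auto intro!: real_root_ge_zero)
  \<comment> \<open>\<open>C1 * R\<close> accounts for \<open>{0..R}\<close>. The rest bounds the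
    integral of \<open>C2 / 2 * (g t + t powr (- 1 - \<epsilon>))\<close> beyond \<open>R\<close>,
    where the power contributes at most \<open>R powr (- \<epsilon>) / \<epsilon>\<close>.\<close>
  define L where "L = C1 * R + C2 / 2 * (I + R powr (- \<epsilon>) / \<epsilon>)"
  have I0: "I \<ge> 0" using I[of R] by simp
  have le_L: "F (picard v r) \<le> L"
    if v: "profile v" and le: "\<And>s. s \<ge> 0 \<Longrightarrow> v s \<le> picard v s" and r: "r \<ge> 0" for v r
  proof -
    define FV' where "FV' = (\<lambda>t. t * slope v t / root (k + 1) (real (k + 1) * H (picard v t)))"
    have FV'_within: "((\<lambda>t. F (picard v t)) has_real_derivative FV' t) (at t within {0..})" if "t \<ge> 0" for t
      unfolding FV'_def by (rule DERIV_F_picard[OF v that])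
    have FV': "((\<lambda>t. F (picard v t)) has_real_derivative FV' t) (at t)" if "t > 0" for t
      using FV'_within[of t] that by (simp add: at_within_interior[of t "{0..}"])
    have FV_cont: "continuous_on {0..} (\<lambda>t. F (picard v t))"
      using FV'_within by (intro DERIV_continuous_on[of _ _ FV']) auto
    have near: "F (picard v r) \<le> C1 * r" if r: "0 \<le> r" "r \<le> R" for r
    proof -
      \<comment> \<open>Below \<open>R\<close> the estimate is applied with
        \<open>\<psi> = M\<close>. The difference starts from 0 because
        \<open>picard v 0 = 1\<close> and \<open>F 1 = 0\<close>.\<close>
      have "C1 * 0 - F (picard v 0) \<le> C1 * r - F (picard v r)"
      proof (rule DERIV_nonneg_imp_increasing_open[OF r(1)])
        fix t assume t: "0 < t" "t < r"
        have "FV' t \<le> root (k + 1) (c / real k * t ^ (k - 1) * M)"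
          unfolding FV'_def
          using t r p_pos e0
          by (intro slope_estimate v le mult_mono powr_mono2 M) (auto simp: less_imp_le)
        also have "\<dots> \<le> C1"
          unfolding C1_def using t r c_pos M0
          by (intro real_root_le_mono mult_right_mono mult_left_mono power_mono) auto
        finally show "\<exists>y. ((\<lambda>t. C1 * t - F (picard v t)) has_real_derivative y) (at t) \<and> 0 \<le> y"
          using FV'[OF t(1)] by (intro exI[of _ "C1 - FV' t"]) (auto intro!: derivative_eq_intros)
      qed (auto intro!: continuous_intros continuous_on_subset[OF FV_cont])
      then show ?thesis by (simp add: picard_def F_def)
    qed
    show ?thesis
    proof (cases "r \<le> R")
      case True
      then have "F (picard v r) \<le> C1 * R"
        using near[OF r True] C1 by (meson mult_left_mono order_trans)
      also have "\<dots> \<le> L"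
        unfolding L_def using I0 \<epsilon> C2 by simp
      finally show ?thesis .
    next
      case False
      \<comment> \<open>The first term is an antiderivative of the majorant
        \<open>C2 / 2 * (g t + t powr (- 1 - \<epsilon>))\<close>, so the derivative of
        \<open>\<Phi>\<close> is the slack in the bound on \<open>FV'\<close>.\<close>
      define \<Phi> where "\<Phi> = (\<lambda>t. C2 / 2 * (integral {R..t} g - t powr (- \<epsilon>) / \<epsilon>) - F (picard v t))"
      have "\<Phi> R \<le> \<Phi> r"
      proof (rule DERIV_nonneg_imp_increasing_open[where f = \<Phi> and a = R and b = r])
        fix t assume t: "R < t" "t < r"
        then have t0: "t > 0" and pt: "p t > 0" using R p_pos by auto
        have "s powr weight_exp * p s ^ k \<le> t powr weight_exp * (M' * p t ^ k)" if s: "0 < s" "s \<le> t" for s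
        proof (cases "s \<le> R")
          case True
          have "s powr weight_exp * p s ^ k \<le> R powr weight_exp * M"
            using s True R e0 p_pos[of s] by (intro mult_mono powr_mono2 M) auto
          also have "\<dots> = M' * (R powr weight_exp * p R ^ k)"
            using pR p_pos[of R] R by (simp add: M'_def)
          also have "\<dots> \<le> M' * (t powr weight_exp * p t ^ k)"
            using M' t by (intro mult_left_mono mono_onD[OF mono]) auto
          finally show ?thesis by (simp add: mult_ac)
        next
          case False
          then have "s powr weight_exp * p s ^ k \<le> 1 * (t powr weight_exp * p t ^ k)"
            using mono_onD[OF mono, of s t] s by simp
          also have "\<dots> \<le> M' * (t powr weight_exp * p t ^ k)"
            using M' t0 pt by (intro mult_right_mono) auto
          finally show ?thesis by (simp add: mult_ac)
        qed
        then have "FV' t \<le> root (k + 1) (c / real k * t ^ (k - 1) * (M' * p t ^ k))"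
          unfolding FV'_def by (intro slope_estimate v le t0)
        also have "\<dots> = C2 * root (k + 1) (t ^ (k - 1) * p t ^ k)"
          unfolding C2_def real_root_mult[symmetric] by (simp add: mult_ac)
        \<comment> \<open>AM-GM: the square of the left-hand root is \<open>g t * t powr (- 1 - \<epsilon>)\<close>\<close>
        also have "\<dots> \<le> C2 * ((g t + t powr (- 1 - \<epsilon>)) / 2)"
        proof (rule mult_left_mono[OF _ C2])
          have "root (k + 1) (t ^ (k - 1) * p t ^ k) = (t ^ (k - 1) * p t ^ k) powr (1 / real (k + 1))"
            using t0 pt by (intro root_powr_inverse) auto
          also have "\<dots> = t powr ((real k - 1) / (real k + 1)) * p t powr (real k / (real k + 1))"
            using t0 pt k1 by (simp add: powr_mult powr_powr of_nat_diff add_ac flip: powr_realpow)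
          also have "\<dots> = sqrt (g t * t powr (- 1 - \<epsilon>))"
          proof (rule real_sqrt_unique[symmetric])
            have "(t powr ((real k - 1) / (real k + 1)) * p t powr (real k / (real k + 1)))\<^sup>2
                = t powr (2 * (real k - 1) / (real k + 1)) * p t powr (2 * real k / (real k + 1))"
              using t0 pt by (simp add: power_mult_distrib powr_power mult.commute)
            also have "t powr (2 * (real k - 1) / (real k + 1))
                = t powr (1 + \<epsilon> + 2 * (real k - 1) / (real k + 1)) * t powr (- 1 - \<epsilon>)"
              by (simp flip: powr_add)
            finally show "(t powr ((real k - 1) / (real k + 1)) * p t powr (real k / (real k + 1)))\<^sup>2
                = g t * t powr (- 1 - \<epsilon>)"
              by (simp add: g_def mult_ac)
          qed simp
          also have "\<dots> \<le> (g t + t powr (- 1 - \<epsilon>)) / 2"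
            by (intro arith_geo_mean_sqrt) (auto simp: g_def)
          finally show "root (k + 1) (t ^ (k - 1) * p t ^ k) \<le> (g t + t powr (- 1 - \<epsilon>)) / 2" .
        qed
        finally have le': "FV' t \<le> C2 / 2 * (g t + t powr (- 1 - \<epsilon>))" by simp
        have "((\<lambda>t. integral {R..t} g) has_real_derivative g t) (at t within {R..})"
          using t by (intro has_real_derivative_integral_atLeast g_cont) auto
        then have "((\<lambda>t. integral {R..t} g) has_real_derivative g t) (at t)"
          using t by (simp add: at_within_interior[of t "{R..}"])
        moreover have "((\<lambda>t. t powr (- \<epsilon>) / \<epsilon>) has_real_derivative - (t powr (- 1 - \<epsilon>))) (at t)"
          using \<epsilon> DERIV_cdivide[OF has_real_derivative_powr[OF t0, of "- \<epsilon>"], of \<epsilon>]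
          by (simp add: minus_diff_commute)
        ultimately have "(\<Phi> has_real_derivative
            C2 / 2 * (g t - - (t powr (- 1 - \<epsilon>))) - FV' t) (at t)"
          unfolding \<Phi>_def using FV'[OF t0] by (intro DERIV_diff DERIV_cmult)
        then show "\<exists>y. (\<Phi> has_real_derivative y) (at t) \<and> 0 \<le> y"
          using le' by (intro exI conjI) auto
      next
        show "continuous_on {R..r} \<Phi>"
          unfolding \<Phi>_def using R \<epsilon>
          by (intro continuous_intros indefinite_integral_continuous_1 integrable_continuous_interval
                continuous_on_subset[OF g_cont] continuous_on_subset[OF FV_cont]) auto
      qed (use False in simp)
      then have "F (picard v r) \<le> F (picard v R)
          + C2 / 2 * (integral {R..r} g + R powr (- \<epsilon>) / \<epsilon> - r powr (- \<epsilon>) / \<epsilon>)"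
        by (simp add: \<Phi>_def algebra_simps)
      also have "\<dots> \<le> C1 * R + C2 / 2 * (I + R powr (- \<epsilon>) / \<epsilon>)"
      proof (intro add_mono near mult_left_mono)
        have "r powr (- \<epsilon>) / \<epsilon> \<ge> 0" using \<epsilon> by simp
        then show "integral {R..r} g + R powr (- \<epsilon>) / \<epsilon> - r powr (- \<epsilon>) / \<epsilon> \<le> I + R powr (- \<epsilon>) / \<epsilon>"
          using I[of r] False unfolding g_def by linarith
      qed (use R C2 in auto)
      finally show ?thesis by (simp add: L_def)
    qed
  qed
  obtain B where B: "B \<ge> 1" "F B > L" using KO by blast
  show thesis
  proof (rule that)
    fix v r assume "profile v" "\<And>s. s \<ge> 0 \<Longrightarrow> v s \<le> picard v s" "(r::real) \<ge> 0"
    from le_L[OF this] B(2) show "picard v r \<le> B"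
      using F_mono[of B "picard v r"] by linarith
  qed
qed

end

section \<open>Existence\<close>

context radial_ode
begin

definition iter :: "nat \<Rightarrow> real \<Rightarrow> real" where
  "iter n = (picard ^^ n) (\<lambda>_. 1)"

lemma iter_Suc: "iter (Suc n) = picard (iter n)"
  by (simp add: iter_def)

lemma profile_iter: "profile (iter n)"
  by (induction n) (auto simp: iter_Suc profile_picard, simp add: iter_def profile_def)

text \<open>This says both that the iterates increase and that each is a subsolution. It starts from
  \<open>picard\<close> having values at least 1 and propagates by
  \<open>picard_mono\<close>.\<close>

lemma iter_le_picard:
  assumes "s \<ge> 0"
  shows "iter n s \<le> picard (iter n) s"
  using assms
proof (induction n arbitrary: s)
  case 0
  then show ?case
    using profile_picard[OF profile_iter[of 0]] by (simp add: profile_def iter_def)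
next
  case (Suc n)
  show ?case
    unfolding iter_Suc
    by (rule picard_mono[OF profile_iter profile_picard[OF profile_iter] Suc.IH])
qed

text \<open>Increasing bounded iterates converge pointwise; dominated convergence passes to the
  limit first in \<open>avg\<close>, then in \<open>picard\<close>.\<close>

lemma bounded_fixed_point:
  assumes bound: "\<And>v r. profile v \<Longrightarrow> (\<And>s. s \<ge> 0 \<Longrightarrow> v s \<le> picard v s) \<Longrightarrow> r \<ge> 0 \<Longrightarrow> picard v r \<le> B"
  obtains v where "profile v" "\<And>r. r \<ge> 0 \<Longrightarrow> v r = picard v r" "\<And>r. r \<ge> 0 \<Longrightarrow> v r \<le> B"
proof -
  define v where "v = (\<lambda>r. lim (\<lambda>n. iter n r))"
  have le_B: "iter n r \<le> B" if "r \<ge> 0" for n r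
    by (rule order_trans[OF iter_le_picard bound[OF profile_iter iter_le_picard]]) (use that in auto)
  have ge_1: "iter n r \<ge> 1" if "r \<ge> 0" for n r
    using profile_iter[of n] that by (simp add: profile_def)
  have lim: "(\<lambda>n. iter n r) \<longlonglongrightarrow> v r" if r: "r \<ge> 0" for r
  proof -
    have "incseq (\<lambda>n. iter n r)"
      using iter_le_picard[OF r] by (intro incseq_SucI) (simp add: iter_Suc)
    then obtain l where "(\<lambda>n. iter n r) \<longlonglongrightarrow> l"
      using incseq_convergent[of "\<lambda>n. iter n r" B] le_B[OF r] by blast
    then show ?thesis by (simp add: v_def limI)
  qed
  have v1: "v r \<ge> 1" if "r \<ge> 0" for r
    by (rule LIMSEQ_le_const[OF lim[OF that]]) (use ge_1[OF that] in auto)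
  have vB: "v r \<le> B" if "r \<ge> 0" for r
    by (rule LIMSEQ_le_const2[OF lim[OF that]]) (use le_B[OF that] in auto)
  \<comment> \<open>The constant \<open>B\<close> is itself a profile; its \<open>src\<close> and
    \<open>slope\<close> dominate those of all iterates.\<close>
  have prof_B: "profile (\<lambda>_. B)"
    using v1[of 0] vB[of 0] by (auto simp: profile_def)
  have src_lim: "(\<lambda>n. src (iter n) s) \<longlonglongrightarrow> src v s" if "s \<ge> 0" for s
  proof -
    have "isCont h (v s)"
      using continuous_on_interior[OF h_cont, of "v s"] v1[OF that] by simp
    then show ?thesis
      unfolding src_def by (intro tendsto_intros isCont_tendsto_compose[of _ h] lim that)
  qed
  have src_le: "src (iter n) s \<le> src (\<lambda>_. B) s" if "s \<ge> 0" for n s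
    unfolding src_def using ge_1[OF that, of n] le_B[OF that, of n] p_pos[OF that] h_pos[of "iter n s"]
    by (intro power_mono mult_left_mono mono_onD[OF h_mono] mult_nonneg_nonneg) auto
  have slope_lim: "(\<lambda>n. slope (iter n) t) \<longlonglongrightarrow> slope v t" if "t \<ge> 0" for t
  proof -
    have "(\<lambda>n. avg N (src (iter n)) t) \<longlonglongrightarrow> avg N (src v) t"
      unfolding avg_def
    proof (rule dominated_convergence(2))
      show "(\<lambda>\<sigma>. \<sigma> ^ (N - 1) * src (iter n) (t * \<sigma>)) integrable_on {0..1}" for n
        by (intro integrable_continuous_interval avg_integrand_continuous continuous_on_src
              profile_iter that)
      show "(\<lambda>\<sigma>. \<sigma> ^ (N - 1) * src (\<lambda>_. B) (t * \<sigma>)) integrable_on {0..1}"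
        by (intro integrable_continuous_interval avg_integrand_continuous continuous_on_src
              prof_B that)
      show "norm (\<sigma> ^ (N - 1) * src (iter n) (t * \<sigma>)) \<le> \<sigma> ^ (N - 1) * src (\<lambda>_. B) (t * \<sigma>)"
        if "\<sigma> \<in> {0..1}" for n \<sigma>
        using that \<open>t \<ge> 0\<close> src_pos[OF profile_iter[of n], of "t * \<sigma>"] src_le[of "t * \<sigma>" n]
        by (auto simp: abs_mult intro!: mult_left_mono)
      show "(\<lambda>n. \<sigma> ^ (N - 1) * src (iter n) (t * \<sigma>)) \<longlonglongrightarrow> \<sigma> ^ (N - 1) * src v (t * \<sigma>)"
        if "\<sigma> \<in> {0..1}" for \<sigma>
        using that \<open>t \<ge> 0\<close> by (intro tendsto_intros src_lim) auto
    qed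
    then show ?thesis
      unfolding slope_def by (intro tendsto_intros)
  qed
  \<comment> \<open>Continuity of \<open>v\<close> is not yet available, so integrability also has
    to come from dominated convergence.\<close>
  have fixed: "(\<lambda>t. t * slope v t) integrable_on {0..r}" "v r = picard v r" if r: "r \<ge> 0" for r
  proof -
    have le: "norm (t * slope (iter n) t) \<le> t * slope (\<lambda>_. B) t" if "t \<in> {0..r}" for n t
    proof -
      have "slope (iter n) t \<le> slope (\<lambda>_. B) t"
        using that le_B by (intro slope_mono profile_iter prof_B) auto
      then show ?thesis
        using that slope_pos[OF profile_iter[of n], of t] by (auto simp: abs_mult intro!: mult_left_mono)
    qed
    have conv: "(\<lambda>n. t * slope (iter n) t) \<longlonglongrightarrow> t * slope v t" if "t \<in> {0..r}" for t
      using that by (intro tendsto_intros slope_lim) auto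
    note dom = dominated_convergence[OF integrable_picard[OF profile_iter] integrable_picard[OF prof_B] le conv]
    show "(\<lambda>t. t * slope v t) integrable_on {0..r}" by (rule dom(1))
    have "(\<lambda>n. iter (Suc n) r) \<longlonglongrightarrow> picard v r"
      unfolding iter_Suc picard_def by (intro tendsto_intros dom(2))
    then show "v r = picard v r"
      using LIMSEQ_unique LIMSEQ_Suc[OF lim[OF r]] by blast
  qed
  \<comment> \<open>Continuity is inherited from \<open>picard v\<close>, a constant plus an
    indefinite integral, which agrees with \<open>v\<close> on \<open>{0..}\<close>.\<close>
  have "continuous_on {0..} v"
  proof (rule continuous_on_eq)
    have "continuous (at r within {0..}) (picard v)" if "r \<ge> 0" for r
    proof -
      have "continuous_on {0..r + 1} (picard v)"
        unfolding picard_def[abs_def] using that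
        by (intro continuous_intros indefinite_integral_continuous_1 fixed) auto
      then show ?thesis
        using that by (simp add: continuous_on_eq_continuous_within at_within_atLeast_eq_Icc[of 0 r "r + 1"])
    qed
    then show "continuous_on {0..} (picard v)"
      by (simp add: continuous_on_eq_continuous_within)
  qed (use fixed in auto)
  then show thesis
    using that[of v] v1 vB fixed by (auto simp: profile_def)
qed


text \<open>In \<open>curv\<close> the term \<open>N * slope ^ k\<close> contributes exactly
  \<open>- N / k * slope\<close>; adding it back isolates a positive source term.\<close>

lemma curv_identity:
  assumes "profile v" "t \<ge> 0"
  shows "curv v t + real N / real k * slope v t = c * src v t / (real k * slope v t ^ (k - 1))"
proof -
  have "slope v t ^ k = slope v t ^ (k - 1) * slope v t"
    using k1 by (metis power_minus_mult less_eq_Suc_le One_nat_def)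
  then show ?thesis
    using slope_pos[OF assms] k1 by (simp add: curv_def field_simps)
qed

text \<open>Each \<open>S j\<close> is a positive factor times
  \<open>curv + (N / j) * slope\<close>. Since \<open>N / j \<ge> N / k\<close>,
  \<open>curv_identity\<close> gives positivity; at \<open>j = k\<close> the constant
  \<open>c\<close> normalizes the product to \<open>src v t\<close>.\<close>

lemma hessian_symmetric_functions:
  assumes v: "profile v" and t: "t \<ge> 0" and j: "1 \<le> j" "j \<le> k"
  defines "S \<equiv> \<lambda>j. real (N - 1 choose (j - 1)) * (slope v t + curv v t) * slope v t ^ (j - 1)
      + real (N - 1 choose j) * slope v t ^ j"
  shows "S j > 0" and "S k = src v t"
proof -
  have S: "S j = real (N - 1 choose (j - 1)) * slope v t ^ (j - 1)
      * (curv v t + real N / real j * slope v t)" if j: "1 \<le> j" "j \<le> k" for j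
  proof -
    have 1: "slope v t ^ j = slope v t ^ (j - 1) * slope v t"
      using j by (metis power_minus_mult less_eq_Suc_le One_nat_def)
    have 2: "real (N - 1 choose j) = (real N / real j - 1) * real (N - 1 choose (j - 1))"
      using times_binomial_eq[of j N] j kN by (simp add: field_simps)
    show ?thesis unfolding S_def 1 2 by (simp add: algebra_simps)
  qed
  have pos: "0 < c * src v t / (real k * slope v t ^ (k - 1))"
    using c_pos src_pos[OF v t] slope_pos[OF v t] k1 by simp
  have "real N / real k * slope v t \<le> real N / real j * slope v t"
    using j slope_pos[OF v t] by (intro mult_right_mono divide_left_mono) auto
  then have "0 < curv v t + real N / real j * slope v t"
    using pos curv_identity[OF v t] by linarith
  moreover have "real (N - 1 choose (j - 1)) > 0"
    using j kN by auto
  ultimately show "S j > 0"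
    using S[OF j] slope_pos[OF v t] by simp
  have "real (N - 1 choose (k - 1)) > 0"
    using k1 kN by auto
  then show "S k = src v t"
    using S[of k] k1 slope_pos[OF v t] curv_identity[OF v t] by (simp add: c_def)
qed

end

section \<open>From the radial profile to the solution on the whole space\<close>

theorem theorem1:
  fixes p h :: "real \<Rightarrow> real" and N k :: nat and \<epsilon> :: real
  assumes N: "N = CARD('n::finite)" "N \<ge> 3"
    and k: "k \<ge> 1" "odd N \<Longrightarrow> k \<le> N div 2" "even N \<Longrightarrow> k \<le> N div 2 - 1"
    and p: "continuous_on {0..} p" "\<And>r. r \<ge> 0 \<Longrightarrow> p r > 0"
    and h: "continuous_on {0..} h" "\<And>s. s \<ge> 0 \<Longrightarrow> h s \<ge> 0"
    and p_mono: "\<exists>R>0. mono_on {R..} (\<lambda>r. r powr (real N + real N / real k - 2) * p r ^ k)"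
    and h_mono: "mono_on {0..} h" "h 0 = 0" "\<And>s. s > 0 \<Longrightarrow> h s > 0"
    and keller_osserman:
      "(\<integral>\<^sup>+ t\<in>{1..}. ennreal (1 / root (k + 1) (real (k + 1) * integral {0..t} (\<lambda>z. h z ^ k)))
          \<partial>lborel) = \<infinity>"
    and eps: "\<epsilon> > 0"
    and p_int:
      "(\<integral>\<^sup>+ t\<in>{0..}. ennreal (t powr (1 + \<epsilon> + 2 * (real k - 1) / (real k + 1))
          * p t powr (2 * real k / (real k + 1))) \<partial>lborel) < \<infinity>"
  shows "\<exists>u :: real ^ 'n \<Rightarrow> real.
           u \<in> admissible k \<and>
           (\<forall>x. root k (elem_sym k (eigenvalues (hessian u x))) = p (norm x) * h (u x)) \<and>
           (\<forall>x. u x \<ge> 0) \<and>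
           (\<exists>x. u x \<noteq> 0) \<and>
           (\<forall>x y. norm x = norm y \<longrightarrow> u x = u y) \<and>
           bounded (range u)"
proof -
  have "k \<le> N"
    using k N(2) by (cases "even N") (auto intro: le_trans[OF _ div_le_dividend] le_trans[OF _ diff_le_self])
  then interpret radial_ode p h N k
    using k p h h_mono by unfold_locales auto
  define g where "g = (\<lambda>t. t powr (1 + \<epsilon> + 2 * (real k - 1) / (real k + 1))
          * p t powr (2 * real k / (real k + 1)))"
  define I where "I = enn2real (\<integral>\<^sup>+ t\<in>{0..}. ennreal (g t) \<partial>lborel)"
  obtain R where R: "R > 0" "mono_on {R..} (\<lambda>r. r powr weight_exp * p r ^ k)"
    using p_mono unfolding weight_exp_def by blast
  have I_le: "integral {R..r} g \<le> I" if "r \<ge> R" for r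
  proof -
    have "continuous_on {R..r} g"
      unfolding g_def using R(1) p(2)
      by (intro continuous_intros continuous_on_subset[OF p(1)]) (auto simp: order.strict_iff_order)
    then have "ennreal (integral {R..r} g) = (\<integral>\<^sup>+t\<in>{R..r}. ennreal (g t) \<partial>lborel)"
      by (intro set_nn_integral_Icc_eq_integral[symmetric]) (auto simp: g_def)
    also have "\<dots> \<le> (\<integral>\<^sup>+ t\<in>{0..}. ennreal (g t) \<partial>lborel)"
      using R(1) by (intro nn_integral_mono) (auto simp: indicator_def)
    also have "\<dots> = ennreal I"
      using p_int by (simp add: I_def g_def)
    finally show ?thesis
      by (simp add: I_def)
  qed
  have KO: "\<exists>B\<ge>1. F B > L" for L
  proof (rule ccontr)
    assume "\<not> ?thesis"
    then have "F B \<le> L" if "B \<ge> 1" for B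
      using that by force
    then have "(\<integral>\<^sup>+ t\<in>{1..}. ennreal (1 / root (k + 1) (real (k + 1) * H t)) \<partial>lborel) \<le> ennreal L"
      using H_pos unfolding F_def
      by (intro set_nn_integral_atLeast_le continuous_on_F_integrand)
         (auto intro!: divide_nonneg_nonneg real_root_ge_zero simp: less_imp_le)
    with keller_osserman show False
      unfolding H_def by (simp add: top_unique)
  qed
  obtain B where B: "\<And>v r. profile v \<Longrightarrow> (\<And>s. s \<ge> 0 \<Longrightarrow> v s \<le> picard v s) \<Longrightarrow> r \<ge> 0 \<Longrightarrow> picard v r \<le> B"
    using a_priori_bound[OF R eps I_le[unfolded g_def] KO] by metis
  obtain v where v: "profile v" and fixed: "\<And>r. r \<ge> 0 \<Longrightarrow> v r = picard v r"
    and v_le: "\<And>r. r \<ge> 0 \<Longrightarrow> v r \<le> B"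
    by (rule bounded_fixed_point[of B]) (blast intro: B)+
  \<comment> \<open>\<open>picard v\<close> takes the place of \<open>v\<close> because
    \<open>DERIV_picard\<close> gives its derivative; the two agree at every norm.\<close>
  interpret radial_profile "picard v" "slope v" "curv v"
    by unfold_locales
       (auto intro: DERIV_picard DERIV_slope continuous_on_slope continuous_on_curv curv_0 v)
  have lift_eq: "lift x = v (norm x)" for x :: "real ^ 'n"
    by (simp add: lift_def fixed)
  have lift_bounds: "1 \<le> lift x" "lift x \<le> B" for x :: "real ^ 'n"
    using v v_le by (auto simp: lift_eq profile_def)
  have sym: "elem_sym j (eigenvalues (hessian lift x))
      = real (N - 1 choose (j - 1)) * (slope v (norm x) + curv v (norm x)) * slope v (norm x) ^ (j - 1)
        + real (N - 1 choose j) * slope v (norm x) ^ j" if "j \<ge> 1" for j and x :: "real ^ 'n"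
    \<comment> \<open>\<open>undefined\<close> is an arbitrary position for the radial eigenvalue;
      the symmetric functions do not depend on it.\<close>
    by (subst elem_sym_eigenvalue_vector[OF eigenvalue_vector_hessian_lift[of x undefined]],
        subst elem_sym_all_but_one_equal[OF that]) (simp only: N(1))
  show ?thesis
  proof (intro exI[of _ "lift :: real ^ 'n \<Rightarrow> real"] conjI allI impI)
    show "(lift :: real ^ 'n \<Rightarrow> real) \<in> admissible k"
      unfolding admissible_def garding_cone_def
      using C2_lift hessian_symmetric_functions(1)[OF v] by (auto simp: sym)
    show "root k (elem_sym k (eigenvalues (hessian lift x))) = p (norm x) * h (lift x)" for x :: "real ^ 'n"
    proof -
      have "elem_sym k (eigenvalues (hessian lift x)) = (p (norm x) * h (lift x)) ^ k"
        using sym[OF k(1), of x] hessian_symmetric_functions(2)[OF v norm_ge_zero k(1) order_refl, of x]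
        by (simp add: src_def lift_eq)
      then show ?thesis
        using k(1) p(2)[of "norm x"] h(2)[of "lift x"] lift_bounds(1)[of x]
        by (simp add: real_root_power_cancel less_imp_le)
    qed
    show "0 \<le> lift x" for x :: "real ^ 'n"
      using lift_bounds(1)[of x] by simp
    show "\<exists>x::real ^ 'n. lift x \<noteq> 0"
      using lift_bounds(1)[of 0] by (intro exI[of _ 0]) linarith
    show "lift x = lift y" if "norm x = norm y" for x y :: "real ^ 'n"
      using that by (simp add: lift_def)
    show "bounded (range (lift :: real ^ 'n \<Rightarrow> real))"
      by (rule bounded_subset[OF bounded_closed_interval[of 1 B]]) (use lift_bounds in auto)
  qed
qed

end
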